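(* Let $S_t$ be the position at time $t$ of the particle in the random trial-based telegraph process with velocities $c>0$ and $-v<0$ and trial parameters $b,r>0$, $A\ge 0$ described in the context. Then for all $t>0$ $$\mathbb{P}\{S_t=ct\}=\frac{b}{b+r}\,\overline{F}_{U_1}(t)+\sum_{k=1}^{+\infty}\mathbb{P}\{Z_0=c,\,N_k=k\}\left[F_U^{(k)}(t)-F_U^{(k+1)}(t)\right],$$ where $$\mathbb{P}\{Z_0=c,N_k=k\}=\begin{cases}p^{k+1} & \text{if } A=0,\\[2mm] \dfrac{b}{b+r}\left(\dfrac{b+A}{A}\right)_k\left[\left(\dfrac{b+A+r}{A}\right)_k\right]^{-1} & \text{if } A>0,\end{cases}$$ and $$\mathbb{P}\{S_t=-vt\}=\frac{r}{b+r}\,\overline{F}_{D_1}(t)+\sum_{k=1}^{+\infty}\mathbb{P}\{Z_0=-v,\,N_k=0\}\left[F_D^{(k)}(t)-F_D^{(k+1)}(t)\right],$$ where $$\mathbb{P}\{Z_0=-v,N_k=0\}=\begin{cases}(1-p)^{k+1} & \text{if } A=0,\\[2mm] \dfrac{r}{b+r}\left(\dfrac{r+A}{A}\right)_k\left[\left(\dfrac{b+A+r}{A}\right)_k\right]^{-1} & \text{if } A>0.\end{cases}$$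
   Context: Model. Fix $c,v>0$, $b,r>0$ and $A\ge 0$, and set $p=b/(b+r)$. Let $\{X_n;n\ge1\}$ be $\{0,1\}$-valued random variables with $\mathbb{P}\{X_1=1\}=\frac{b}{b+r}$ and, for $n\ge1$, $\mathbb{P}\{X_{n+1}=1\mid \sigma(X_1,\dots,X_n)\}=\frac{b+A\sum_{k=1}^nX_k}{b+r+An}$ (for $A=0$ these are i.i.d. Bernoulli trials with parameter $p$; for $A>0$ they are the outcomes of a classical Pólya urn). Put $Z_n=c$ if $X_{n+1}=1$ and $Z_n=-v$ if $X_{n+1}=0$, $n\ge 0$. Let $\{U_k;k\ge1\}$ and $\{D_k;k\ge1\}$ be mutually independent sequences of non-negative, absolutely continuous, independent random variables (not necessarily identically distributed), the collection $\{U_k,D_k;k\ge1\}$ being independent of $\{X_n;n\ge1\}$. $U_k$ (resp. $D_k$) is the duration of the $k$-th period during which the particle has velocity $c$ (resp. $-v$): $T_0=0$ and, for $n\ge0$, with $j_n=X_1+\cdots+X_{n+1}$, $T_{n+1}=T_n+U_{j_n}$ if $X_{n+1}=1$ and $T_{n+1}=T_n+D_{n+1-j_n}$ if $X_{n+1}=0$. Let $M_t=\max\{i\ge1:T_i\le t\}$ (with $M_t=0$ if $T_1>t$); it is assumed that $T_n\to\infty$ almost surely, so that $M_t$ is finite. The velocity and position at time $t$ are $V_t=Z_{M_t}$ and $S_t=\int_0^tV_s\,ds$, so $S_0=0$ and $V_0=Z_0$. Notation. $N_0=0$ and $N_{k}=\sum_{i=1}^{k}\mathbf{1}_{\{Z_i=c\}}=\sum_{h=2}^{k+1}X_h$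 for $k\ge1$. $\overline{F}_{U_1},\overline{F}_{D_1}$ are the tail distribution functions of $U_1$, $D_1$ (i.e. $\overline F_{U_1}(t)=\mathbb{P}\{U_1>t\}$); $F_U^{(k)}$, $F_D^{(k)}$ are the cumulative distribution functions of $U^{(k)}=U_1+\cdots+U_k$ and $D^{(k)}=D_1+\cdots+D_k$. $(\alpha)_0=1$, $(\alpha)_k=\alpha(\alpha+1)\cdots(\alpha+k-1)$ is the ascending factorial. *)

theory Defs
  imports "HOL-Probability.Probability"
begin

(* The sigma-algebra on space M generated by the N-valued maps Y i, i in I. *)
definition generated_algebra ::
    "'a measure \<Rightarrow> 'i set \<Rightarrow> 'b measure \<Rightarrow> ('i \<Rightarrow> 'a \<Rightarrow> 'b) \<Rightarrow> 'a measure" where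
  "generated_algebra M I N Y =
     vimage_algebra (space M) (\<lambda>\<omega>. \<lambda>i\<in>I. Y i \<omega>) (PiM I (\<lambda>_. N))"

(* The sequences X, U, D are indexed from 1 as in the model; their values at index 0 are
   never used and nothing is assumed about them. *)

definition trial_velocity :: "real \<Rightarrow> real \<Rightarrow> (nat \<Rightarrow> 'a \<Rightarrow> nat) \<Rightarrow> nat \<Rightarrow> 'a \<Rightarrow> real" where
  "trial_velocity c v X n \<omega> = (if X (Suc n) \<omega> = 1 then c else - v)"

definition success_count :: "(nat \<Rightarrow> 'a \<Rightarrow> nat) \<Rightarrow> nat \<Rightarrow> 'a \<Rightarrow> nat" where
  "success_count X n \<omega> = (\<Sum>k=1..Suc n. X k \<omega>)"

primrec switch_time ::
    "(nat \<Rightarrow> 'a \<Rightarrow> nat) \<Rightarrow> (nat \<Rightarrow> 'a \<Rightarrow> real) \<Rightarrow> (nat \<Rightarrow> 'a \<Rightarrow> real) \<Rightarrow> nat \<Rightarrow> 'a \<Rightarrow> real" where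
  "switch_time X U D 0 \<omega> = 0"
| "switch_time X U D (Suc n) \<omega> = switch_time X U D n \<omega> +
     (if X (Suc n) \<omega> = 1 then U (success_count X n \<omega>) \<omega>
      else D (Suc n - success_count X n \<omega>) \<omega>)"

(* Max is meaningful only where the set is finite, which holds almost surely in the model. *)
definition switch_count ::
    "(nat \<Rightarrow> 'a \<Rightarrow> nat) \<Rightarrow> (nat \<Rightarrow> 'a \<Rightarrow> real) \<Rightarrow> (nat \<Rightarrow> 'a \<Rightarrow> real) \<Rightarrow> real \<Rightarrow> 'a \<Rightarrow> nat" where
  "switch_count X U D t \<omega> =
     (if switch_time X U D 1 \<omega> > t then 0
      else Max {i. 1 \<le> i \<and> switch_time X U D i \<omega> \<le> t})"

definition velocity ::
    "real \<Rightarrow> real \<Rightarrow> (nat \<Rightarrow> 'a \<Rightarrow> nat) \<Rightarrow> (nat \<Rightarrow> 'a \<Rightarrow> real) \<Rightarrow> (nat \<Rightarrow> 'a \<Rightarrow> real)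
      \<Rightarrow> real \<Rightarrow> 'a \<Rightarrow> real" where
  "velocity c v X U D t \<omega> = trial_velocity c v X (switch_count X U D t \<omega>) \<omega>"

definition position ::
    "real \<Rightarrow> real \<Rightarrow> (nat \<Rightarrow> 'a \<Rightarrow> nat) \<Rightarrow> (nat \<Rightarrow> 'a \<Rightarrow> real) \<Rightarrow> (nat \<Rightarrow> 'a \<Rightarrow> real)
      \<Rightarrow> real \<Rightarrow> 'a \<Rightarrow> real" where
  "position c v X U D t \<omega> = (LBINT s:{0..t}. velocity c v X U D s \<omega>)"

(* The initial velocity, at index 0, is not counted. *)
definition forward_count :: "real \<Rightarrow> real \<Rightarrow> (nat \<Rightarrow> 'a \<Rightarrow> nat) \<Rightarrow> nat \<Rightarrow> 'a \<Rightarrow> nat" where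
  "forward_count c v X k \<omega> = (\<Sum>i=1..k. of_bool (trial_velocity c v X i \<omega> = c))"

definition tail_df :: "'a measure \<Rightarrow> ('a \<Rightarrow> real) \<Rightarrow> real \<Rightarrow> real" where
  "tail_df M Y t = \<P>(\<omega> in M. Y \<omega> > t)"

definition partial_sum_cdf :: "'a measure \<Rightarrow> (nat \<Rightarrow> 'a \<Rightarrow> real) \<Rightarrow> nat \<Rightarrow> real \<Rightarrow> real" where
  "partial_sum_cdf M Y k t = cdf (distr M borel (\<lambda>\<omega>. \<Sum>i=1..k. Y i \<omega>)) t"

locale trial_telegraph = prob_space M for M :: "'a measure" +
  fixes c v b r A :: real
    and X :: "nat \<Rightarrow> 'a \<Rightarrow> nat" and U D :: "nat \<Rightarrow> 'a \<Rightarrow> real"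
  assumes c_pos: "c > 0" and v_pos: "v > 0"
    and b_pos: "b > 0" and r_pos: "r > 0" and A_nonneg: "A \<ge> 0"
    and X_measurable: "\<And>n. n \<ge> 1 \<Longrightarrow> X n \<in> M \<rightarrow>\<^sub>M count_space {0, 1}"
    and X_first: "prob {\<omega> \<in> space M. X 1 \<omega> = 1} = b / (b + r)"
    and X_step: "\<And>n. n \<ge> 1 \<Longrightarrow>
      AE \<omega> in M.
        real_cond_exp M (generated_algebra M {1..n} (count_space UNIV) X)
          (indicator {\<omega> \<in> space M. X (Suc n) \<omega> = 1}) \<omega>
        = (b + A * (\<Sum>k=1..n. real (X k \<omega>))) / (b + r + A * real n)"
    and U_nonneg: "\<And>k. k \<ge> 1 \<Longrightarrow> AE \<omega> in M. U k \<omega> \<ge> 0"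
    and D_nonneg: "\<And>k. k \<ge> 1 \<Longrightarrow> AE \<omega> in M. D k \<omega> \<ge> 0"
    and U_abs_cont: "\<And>k. k \<ge> 1 \<Longrightarrow> absolutely_continuous lborel (distr M lborel (U k))"
    and D_abs_cont: "\<And>k. k \<ge> 1 \<Longrightarrow> absolutely_continuous lborel (distr M lborel (D k))"
    (* includes measurability of all U k and D k, k >= 1 *)
    and UD_indep: "indep_vars (\<lambda>_. borel) (case_sum U D) ({1..} <+> {1..})"
    and X_UD_indep: "indep_set
      (sets (generated_algebra M {1..} (count_space UNIV) X))
      (sets (generated_algebra M ({1..} <+> {1..}) borel (case_sum U D)))"
    and switch_time_unbounded:
      "AE \<omega> in M. filterlim (\<lambda>n. switch_time X U D n \<omega>) at_top sequentially"

end

theory Submission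
  imports Defs
begin

text \<open>
  The velocity never exceeds \<open>c\<close>, so the particle is at \<open>c t\<close> at time \<open>t\<close> iff it has moved
  forward during almost all of \<open>[0, t]\<close>. The durations are nonnegative without atoms, hence almost surely
  strictly positive, and a backward sojourn that begins before \<open>t\<close> costs a positive amount
  (\<open>position_eq_max_iff\<close>). Therefore \<open>S\<^sub>t = c t\<close> means that every sojourn begun before \<open>t\<close> is
  forward. Up to that moment the switching times are the sums \<open>U\<^sub>1 + ... + U\<^sub>k\<close>, and almost surely
  there is exactly one \<open>k\<close> such that the first \<open>k + 1\<close> trials are successes and
  \<open>U\<^sub>1 + ... + U\<^sub>k \<le> t < U\<^sub>1 + ... + U\<^sub>k\<^sub>+\<^sub>1\<close> (\<open>AE_position_eq_max_iff_ex1\<close>). A tie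
  \<open>U\<^sub>1 + ... + U\<^sub>k = t\<close> would spoil this equivalence; it has probability zero because a sum of
  independent variables is atomless as soon as one of them is (\<open>AE_sum_neq\<close>).

  Summing over \<open>k\<close> and using the independence of trials and durations gives the series
  (\<open>prob_position_eq_max\<close>): each term is the probability of a run of \<open>k + 1\<close> successes times
  the probability that \<open>t\<close> falls into the sojourn number \<open>k + 1\<close>, and the latter is a difference of
  two distribution functions by monotonicity of the partial sums.

  The formula for \<open>- v t\<close> is the same statement for the reflected motion, in which successes and
  failures, the two sequences of durations, and the two speeds are exchanged (\<open>position_swap\<close>).

  The probability of a run is a product of conditional probabilities
  (\<open>prob_run_then_success\<close>): after \<open>i\<close> successes the urn holds \<open>b + A i\<close> out of \<open>b + r + A i\<close>, and
  symmetrically for failures. This product is a power for \<open>A = 0\<close> and a ratio of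
  ascending factorials for \<open>A > 0\<close> (\<open>prod_affine_ratio\<close>).
\<close>

section \<open>Switching times and paths\<close>

text \<open>
  Sojourns have to be compared as intervals between consecutive switching times; unfolding the
  recursion would turn the right end point into a case distinction.
\<close>

declare switch_time.simps(2) [simp del]

text \<open>
  The durations are only controlled from index 1 on, so the recursion for the switching times must
  be shown never to read index 0: the index of a step is the number of trials, the current one
  included, that had the same outcome.
\<close>

lemma success_count_pos: "X (Suc n) \<omega> = 1 \<Longrightarrow> success_count X n \<omega> \<ge> 1"
  unfolding success_count_def by simp

lemma failure_count_pos:
  assumes X: "\<And>i. i \<ge> 1 \<Longrightarrow> X i \<omega> \<in> {0, 1}" and "X (Suc n) \<omega> \<noteq> 1"
  shows "Suc n - success_count X n \<omega> \<ge> 1"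
proof -
  have "X (Suc n) \<omega> = 0" using X[of "Suc n"] assms(2) by auto
  moreover have "(\<Sum>k=1..n. X k \<omega>) \<le> (\<Sum>k=1..n. 1)"
    using X by (intro sum_mono) force
  ultimately show ?thesis unfolding success_count_def by simp
qed

lemma strict_mono_switch_time:
  assumes X: "\<And>i. i \<ge> 1 \<Longrightarrow> X i \<omega> \<in> {0, 1}"
    and U: "\<And>i. i \<ge> 1 \<Longrightarrow> U i \<omega> > 0" and D: "\<And>i. i \<ge> 1 \<Longrightarrow> D i \<omega> > 0"
  shows "strict_mono (\<lambda>n. switch_time X U D n \<omega>)"
  unfolding strict_mono_Suc_iff
proof
  fix n
  have "Suc n - success_count X n \<omega> \<ge> 1" if "X (Suc n) \<omega> \<noteq> 1"
    by (rule failure_count_pos) (use X that in blast)+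
  then show "switch_time X U D n \<omega> < switch_time X U D (Suc n) \<omega>"
    using U[OF success_count_pos[of X n \<omega>]] D by (simp add: switch_time.simps(2))
qed

lemma switch_time_all_forward:
  assumes "\<forall>i\<in>{1..n}. X i \<omega> = 1"
  shows "switch_time X U D n \<omega> = (\<Sum>i=1..n. U i \<omega>)"
  using assms
proof (induction n)
  case (Suc n)
  have "success_count X n \<omega> = Suc n" unfolding success_count_def using Suc.prems by simp
  then show ?case using Suc by (simp add: switch_time.simps(2))
qed simp

lemma Max_nat_eq_Least:
  fixes S :: "nat set"
  assumes "finite S" "S \<noteq> {}"
  shows "Max S = (LEAST n. \<forall>i>n. i \<notin> S)"
proof (rule Least_equality[symmetric])
  show "\<forall>i>Max S. i \<notin> S" using assms Max_ge leD by blast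
  fix y assume "\<forall>i>y. i \<notin> S"
  then show "Max S \<le> y" using Max_in[OF assms] not_le_imp_less by blast
qed

lemma switch_count_eqI:
  assumes mono: "strict_mono (\<lambda>n. switch_time X U D n \<omega>)"
    and s: "switch_time X U D n \<omega> \<le> s" "s < switch_time X U D (Suc n) \<omega>"
  shows "switch_count X U D s \<omega> = n"
proof (cases "n = 0")
  case True
  then show ?thesis using s by (simp add: switch_count_def)
next
  case False
  have le: "switch_time X U D i \<omega> \<le> s \<longleftrightarrow> i \<le> n" for i
  proof
    assume "switch_time X U D i \<omega> \<le> s"
    then have "switch_time X U D i \<omega> < switch_time X U D (Suc n) \<omega>" using s by simp
    then show "i \<le> n" using strict_mono_less[OF mono, of i "Suc n"] by linarith
  next
    assume "i \<le> n"
    then show "switch_time X U D i \<omega> \<le> s" using strict_mono_less_eq[OF mono, of i n] s by simp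
  qed
  have "{i. 1 \<le> i \<and> switch_time X U D i \<omega> \<le> s} = {1..n}" unfolding le by auto
  moreover have "\<not> switch_time X U D 1 \<omega> > s" unfolding not_less le using False by simp
  moreover have "Max {1..n} = n" using False by (intro Max_eqI) auto
  ultimately show ?thesis unfolding switch_count_def by simp
qed

lemma ex_sojourn_interval:
  fixes T :: "nat \<Rightarrow> real"
  assumes "T 0 \<le> s" "filterlim T at_top sequentially"
  shows "\<exists>n. T n \<le> s \<and> s < T (Suc n)"
proof -
  have "eventually (\<lambda>n. s < T n) sequentially"
    using assms(2) unfolding filterlim_at_top_dense by blast
  then have ex: "\<exists>n. s < T n" by (auto simp: eventually_sequentially)
  define m where "m = (LEAST n. s < T n)"
  have m: "s < T m" unfolding m_def using ex by (rule LeastI_ex)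
  then obtain k where k: "m = Suc k" using assms(1) by (cases m) auto
  have "\<not> s < T k" using not_less_Least[of k "\<lambda>n. s < T n"] k m_def by auto
  then show ?thesis using m k by (intro exI[of _ k]) auto
qed

text \<open>
  The defect \<open>c t - S\<^sub>t\<close> is the integral over \<open>[0, t]\<close> of \<open>c - V\<close>, which is nonnegative. It vanishes iff
  \<open>V = c\<close> almost everywhere on \<open>[0, t]\<close>, that is, iff no sojourn that begins before \<open>t\<close> is a
  backward one: every such sojourn occupies an interval of positive length.
\<close>

lemma position_eq_max_iff:
  assumes c: "c > 0" and v: "v > 0" and t: "t > 0"
    and mono: "strict_mono (\<lambda>n. switch_time X U D n \<omega>)"
    and lim: "filterlim (\<lambda>n. switch_time X U D n \<omega>) at_top sequentially"
    and meas: "(\<lambda>s. velocity c v X U D s \<omega>) \<in> borel_measurable borel"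
  shows "position c v X U D t \<omega> = c * t \<longleftrightarrow>
    (\<forall>n. switch_time X U D n \<omega> < t \<longrightarrow> X (Suc n) \<omega> = 1)"
proof -
  let ?T = "\<lambda>n. switch_time X U D n \<omega>"
  let ?V = "\<lambda>s. velocity c v X U D s \<omega>"
  have V: "?V s = trial_velocity c v X n \<omega>" if "?T n \<le> s" "s < ?T (Suc n)" for n s
    using switch_count_eqI[OF mono that] by (simp add: velocity_def)
  have V_range: "?V s \<in> {c, -v}" for s by (auto simp: velocity_def trial_velocity_def)
  have V_le: "?V s \<le> c" for s using V_range[of s] c v by auto
  have V_bd: "\<bar>?V s\<bar> \<le> c + v" for s using V_range[of s] c v by auto
  have int_const: "set_integrable lborel {0..t} (\<lambda>_. K)" for K :: real
    unfolding set_integrable_def by (intro integrable_scaleR_left integrable_real_indicator)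
      (simp_all add: emeasure_lborel_Icc_eq)
  have int: "set_integrable lborel {0..t} ?V"
    by (rule set_integrable_bound[OF int_const[of "c + v"]])
      (use meas V_bd c v in \<open>auto simp: set_borel_measurable_def\<close>)
  let ?g = "\<lambda>s. indicator {0..t} s * (c - ?V s) :: real"
  have gint: "integrable lborel ?g"
    using set_integral_diff(1)[OF int_const[of c] int] by (simp add: set_integrable_def)
  have "integral\<^sup>L lborel ?g = c * t - position c v X U D t \<omega>"
    using set_integral_diff(2)[OF int_const[of c] int] t
    by (simp add: set_lebesgue_integral_def position_def)
  then have "position c v X U D t \<omega> = c * t \<longleftrightarrow> integral\<^sup>L lborel ?g = 0" by auto
  also have "\<dots> \<longleftrightarrow> (AE s in lborel. ?g s = 0)"
    by (rule integral_nonneg_eq_0_iff_AE[OF gint]) (use V_le in \<open>auto simp: indicator_def\<close>)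
  also have "\<dots> \<longleftrightarrow> (\<forall>n. ?T n < t \<longrightarrow> X (Suc n) \<omega> = 1)"
  proof (intro iffI allI impI)
    fix n assume ae: "AE s in lborel. ?g s = 0" and n: "?T n < t"
    show "X (Suc n) \<omega> = 1"
    proof (rule ccontr)
      assume X: "X (Suc n) \<omega> \<noteq> 1"
      \<comment> \<open>the part of this backward sojourn before time \<open>t\<close>\<close>
      define m where "m = min t (?T (Suc n))"
      have m: "?T n < m" using n mono unfolding m_def strict_mono_Suc_iff by simp
      have T0: "0 \<le> ?T n" using strict_mono_less_eq[OF mono, of 0 n] by simp
      have "?g s \<noteq> 0" if "s \<in> {?T n..<m}" for s
      proof -
        have "?V s = - v" using V[of n s] that X by (simp add: m_def trial_velocity_def)
        then show ?thesis using that T0 c v by (simp add: m_def)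
      qed
      then have "AE s in lborel. s \<notin> {?T n..<m}"
        using ae by (auto elim!: eventually_mono)
      then have "emeasure lborel {?T n..<m} = 0"
        using AE_iff_null_sets[of "{?T n..<m}" lborel] by (auto simp: null_sets_def)
      then show False using m by simp
    qed
  next
    assume all: "\<forall>n. ?T n < t \<longrightarrow> X (Suc n) \<omega> = 1"
    have "?g s = 0" if "s \<noteq> t" for s
    proof (cases "s \<in> {0..t}")
      case True
      obtain n where n: "?T n \<le> s" "s < ?T (Suc n)"
        using ex_sojourn_interval[of ?T s] lim True by auto
      then have "X (Suc n) \<omega> = 1" using all True that by auto
      then show ?thesis using V[OF n] by (simp add: trial_velocity_def)
    qed simp
    moreover have "AE s in lborel. s \<noteq> t" by (rule AE_lborel_singleton)
    ultimately show "AE s in lborel. ?g s = 0" by (auto elim!: eventually_mono)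
  qed
  finally show ?thesis .
qed

text \<open>
  As long as only forward sojourns have begun, the switching times are the partial sums of the
  forward durations. So "all sojourns begun before \<open>t\<close> are forward" can be split according to the
  number \<open>k\<close> of sojourns completed by time \<open>t\<close>. The boundary case in which a switch happens exactly
  at \<open>t\<close> has to be excluded: the trial after it does not influence the position at \<open>t\<close>, but it
  is among the \<open>k + 1\<close> trials required to succeed.
\<close>

lemma all_forward_iff_ex1:
  fixes X :: "nat \<Rightarrow> 'a \<Rightarrow> nat"
  assumes U: "\<And>i. i \<ge> 1 \<Longrightarrow> U i \<omega> > 0" and t: "t > 0"
    and mono: "strict_mono (\<lambda>n. switch_time X U D n \<omega>)"
    and lim: "filterlim (\<lambda>n. switch_time X U D n \<omega>) at_top sequentially"
    and ne: "\<And>k. k \<ge> 1 \<Longrightarrow> (\<Sum>i=1..k. U i \<omega>) \<noteq> t"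
  defines "P \<equiv> \<lambda>k. (\<forall>i\<in>{1..Suc k}. X i \<omega> = 1) \<and>
      (\<Sum>i=1..k. U i \<omega>) \<le> t \<and> t < (\<Sum>i=1..Suc k. U i \<omega>)"
    and "Q \<equiv> \<forall>n. switch_time X U D n \<omega> < t \<longrightarrow> X (Suc n) \<omega> = 1"
  shows "(\<forall>k. P k \<longrightarrow> Q) \<and> (Q \<longrightarrow> (\<exists>!k. P k))"
proof (intro conjI allI impI)
  let ?T = "\<lambda>n. switch_time X U D n \<omega>"
  fix k assume P: "P k"
  have "?T (Suc k) = (\<Sum>i=1..Suc k. U i \<omega>)"
    using P unfolding P_def by (intro switch_time_all_forward) blast
  then have t_less: "t < ?T (Suc k)" using P unfolding P_def by simp
  show Q unfolding Q_def
  proof (intro allI impI)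
    fix n assume "?T n < t"
    then have "?T n < ?T (Suc k)" using t_less by simp
    then have "Suc n \<le> Suc k" using strict_mono_less[OF mono, of n "Suc k"] by linarith
    then show "X (Suc n) \<omega> = 1" using P unfolding P_def by auto
  qed
next
  let ?T = "\<lambda>n. switch_time X U D n \<omega>"
  assume Q: Q
  obtain n where n: "?T n \<le> t" "t < ?T (Suc n)"
    using ex_sojourn_interval[of ?T t] lim t by auto
  have X: "X (Suc i) \<omega> = 1" if "i < n" for i
    using Q n(1) strict_mono_less[OF mono, of i n] that unfolding Q_def by auto
  have X': "\<forall>i\<in>{1..n}. X i \<omega> = 1"
  proof
    fix i assume "i \<in> {1..n}"
    then show "X i \<omega> = 1" using X[of "i - 1"] by auto
  qed
  have Tn: "?T n = (\<Sum>i=1..n. U i \<omega>)" by (rule switch_time_all_forward) (rule X')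
  have "?T n < t" using n(1) Tn ne[of n] t by (cases "n = 0") auto
  then have "X (Suc n) \<omega> = 1" using Q unfolding Q_def by blast
  then have X'': "\<forall>i\<in>{1..Suc n}. X i \<omega> = 1" using X' le_Suc_eq by auto
  have TSn: "?T (Suc n) = (\<Sum>i=1..Suc n. U i \<omega>)" by (rule switch_time_all_forward) (rule X'')
  have Pn: "P n" unfolding P_def using X'' n Tn TSn by (simp del: sum.cl_ivl_Suc)
  have smono: "strict_mono (\<lambda>k. \<Sum>i=1..k. U i \<omega>)"
    unfolding strict_mono_Suc_iff using U by simp
  have less: "\<not> (P j \<and> P k)" if "j < k" for j k
  proof
    assume "P j \<and> P k"
    then have "t < (\<Sum>i=1..Suc j. U i \<omega>)" "(\<Sum>i=1..k. U i \<omega>) \<le> t" unfolding P_def by auto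
    moreover have "(\<Sum>i=1..Suc j. U i \<omega>) \<le> (\<Sum>i=1..k. U i \<omega>)"
      using strict_mono_less_eq[OF smono, of "Suc j" k] that by simp
    ultimately show False by simp
  qed
  show "\<exists>!k. P k"
    using Pn less by (metis linorder_less_linear)
qed

section \<open>The probability of having moved only forward\<close>

text \<open>
  This locale keeps only what the argument on extremal positions uses about the motion, whatever
  the law of the trials. The conditions pass directly to the motion with the two directions
  exchanged, so one proof serves both.
\<close>

locale two_speed_motion = prob_space M for M :: "'a measure" +
  fixes c v :: real and X :: "nat \<Rightarrow> 'a \<Rightarrow> nat" and U D :: "nat \<Rightarrow> 'a \<Rightarrow> real"
  assumes c_pos: "c > 0" and v_pos: "v > 0"
    and X_measurable: "\<And>n. n \<ge> 1 \<Longrightarrow> X n \<in> M \<rightarrow>\<^sub>M count_space {0, 1}"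
    and U_measurable: "\<And>k. k \<ge> 1 \<Longrightarrow> U k \<in> borel_measurable M"
    and D_measurable: "\<And>k. k \<ge> 1 \<Longrightarrow> D k \<in> borel_measurable M"
    and U_pos: "\<And>k. k \<ge> 1 \<Longrightarrow> AE \<omega> in M. U k \<omega> > 0"
    and D_pos: "\<And>k. k \<ge> 1 \<Longrightarrow> AE \<omega> in M. D k \<omega> > 0"
    and switch_time_unbounded:
      "AE \<omega> in M. filterlim (\<lambda>n. switch_time X U D n \<omega>) at_top sequentially"
begin

lemma X_range: "\<omega> \<in> space M \<Longrightarrow> n \<ge> 1 \<Longrightarrow> X n \<omega> \<in> {0, 1}"
  using measurable_space[OF X_measurable] by simp

lemma X_measurable_UNIV: "n \<ge> 1 \<Longrightarrow> X n \<in> M \<rightarrow>\<^sub>M count_space UNIV"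
  using X_measurable measurable_compose[of "X n" M "count_space {0, 1}" "\<lambda>x. x"] by simp

lemma success_count_measurable: "success_count X n \<in> M \<rightarrow>\<^sub>M count_space UNIV"
  unfolding success_count_def using X_measurable_UNIV by (intro measurable_sum_nat) auto

lemma switch_time_measurable: "switch_time X U D n \<in> borel_measurable M"
proof (induction n)
  case (Suc n)
  \<comment> \<open>Durations are indexed by random counts, so they are first made measurable at every index.\<close>
  have U0: "(\<lambda>\<omega>. if k \<ge> 1 then U k \<omega> else 0) \<in> borel_measurable M" for k
    using U_measurable[of k] by (cases "k \<ge> 1") auto
  have D0: "(\<lambda>\<omega>. if k \<ge> 1 then D k \<omega> else 0) \<in> borel_measurable M" for k
    using D_measurable[of k] by (cases "k \<ge> 1") auto
  have fc: "(\<lambda>\<omega>. Suc n - success_count X n \<omega>) \<in> M \<rightarrow>\<^sub>M count_space UNIV"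
    using success_count_measurable by (rule measurable_compose) simp
  have [measurable]: "X (Suc n) \<in> M \<rightarrow>\<^sub>M count_space UNIV" by (rule X_measurable_UNIV) simp
  note [measurable] = Suc
    measurable_compose_countable[of "\<lambda>k \<omega>. if k \<ge> 1 then U k \<omega> else 0", OF U0 success_count_measurable]
    measurable_compose_countable[of "\<lambda>k \<omega>. if k \<ge> 1 then D k \<omega> else 0", OF D0 fc]
  have "(\<lambda>\<omega>. switch_time X U D n \<omega> +
      (if X (Suc n) \<omega> = 1
       then (if success_count X n \<omega> \<ge> 1 then U (success_count X n \<omega>) \<omega> else 0)
       else (if Suc n - success_count X n \<omega> \<ge> 1
             then D (Suc n - success_count X n \<omega>) \<omega> else 0))) \<in> borel_measurable M"
    by measurable
  also have "?this \<longleftrightarrow> ?case"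
  proof (rule measurable_cong)
    fix \<omega> assume w: "\<omega> \<in> space M"
    show "switch_time X U D n \<omega> +
      (if X (Suc n) \<omega> = 1
       then (if success_count X n \<omega> \<ge> 1 then U (success_count X n \<omega>) \<omega> else 0)
       else (if Suc n - success_count X n \<omega> \<ge> 1
             then D (Suc n - success_count X n \<omega>) \<omega> else 0)) = switch_time X U D (Suc n) \<omega>"
      using success_count_pos[of X n \<omega>] failure_count_pos[of X \<omega> n] X_range[OF w]
      by (auto simp: switch_time.simps(2))
  qed
  finally show ?case .
qed simp

text \<open>
  The event that the position takes a given value must be measurable on the whole space, including
  the null set of paths with infinitely many switches in bounded time. There the maximum that defines
  the number of switches is taken over an infinite set and has a default value that does not depend
  on the path, so the number of switches is jointly measurable in time and path.
\<close>

lemma velocity_measurable: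
  "(\<lambda>(s, \<omega>). velocity c v X U D s \<omega>) \<in> borel_measurable (borel \<Otimes>\<^sub>M M)"
proof -
  note [measurable] = switch_time_measurable
  have count_eq: "switch_count X U D s \<omega> =
    (if switch_time X U D 1 \<omega> > s then 0
     else if \<exists>n. \<forall>i>n. \<not> switch_time X U D i \<omega> \<le> s
     then LEAST n. \<forall>i>n. \<not> switch_time X U D i \<omega> \<le> s
     else the None)" for s \<omega>
  proof (cases "switch_time X U D 1 \<omega> > s")
    case True then show ?thesis by (simp add: switch_count_def)
  next
    case False
    let ?S = "{i. 1 \<le> i \<and> switch_time X U D i \<omega> \<le> s}"
    have fin: "finite ?S \<longleftrightarrow> (\<exists>n. \<forall>i>n. \<not> switch_time X U D i \<omega> \<le> s)"
    proof
      assume "finite ?S"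
      then obtain n where "\<forall>i\<in>?S. i \<le> n" using finite_nat_set_iff_bounded_le by blast
      then show "\<exists>n. \<forall>i>n. \<not> switch_time X U D i \<omega> \<le> s"
        by (metis (mono_tags, lifting) Suc_leI leD less_nat_zero_code mem_Collect_eq not_gr_zero One_nat_def)
    next
      assume "\<exists>n. \<forall>i>n. \<not> switch_time X U D i \<omega> \<le> s"
      then obtain n where "\<forall>i>n. \<not> switch_time X U D i \<omega> \<le> s" by blast
      then have "?S \<subseteq> {..n}" using not_le_imp_less by blast
      then show "finite ?S" using finite_subset by blast
    qed
    show ?thesis
    proof (cases "finite ?S")
      case True
      have "?S \<noteq> {}" using False by (auto intro!: exI[of _ 1])
      moreover have "(\<forall>i>n. i \<notin> ?S) = (\<forall>i>n. \<not> switch_time X U D i \<omega> \<le> s)" for n by auto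
      ultimately show ?thesis
        using Max_nat_eq_Least[OF True] fin True False by (simp add: switch_count_def)
    next
      case nfin: False
      then have "\<nexists>n. \<forall>i>n. \<not> switch_time X U D i \<omega> \<le> s" using fin by blast
      then show ?thesis
        using False Max.infinite[OF nfin] unfolding switch_count_def by (simp only: if_False)
    qed
  qed
  have [measurable]: "(\<lambda>x. switch_count X U D (fst x) (snd x))
      \<in> borel \<Otimes>\<^sub>M M \<rightarrow>\<^sub>M count_space UNIV"
    unfolding count_eq by measurable
  have tv: "(\<lambda>x. trial_velocity c v X n (snd x)) \<in> borel_measurable (borel \<Otimes>\<^sub>M M)" for n
  proof -
    have [measurable]: "X (Suc n) \<in> M \<rightarrow>\<^sub>M count_space UNIV" by (rule X_measurable_UNIV) simp
    show ?thesis unfolding trial_velocity_def by measurable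
  qed
  show ?thesis unfolding velocity_def case_prod_beta
    by (rule measurable_compose_countable[OF tv]) measurable
qed

lemma position_measurable: "position c v X U D t \<in> borel_measurable M"
proof -
  have "(\<lambda>x. velocity c v X U D (snd x) (fst x)) \<in> borel_measurable (M \<Otimes>\<^sub>M borel)"
    using measurable_compose[OF measurable_pair_swap' velocity_measurable]
    by (simp add: case_prod_beta)
  moreover have "sets (M \<Otimes>\<^sub>M lborel) = sets (M \<Otimes>\<^sub>M borel)"
    by (rule sets_pair_measure_cong) simp_all
  ultimately have [measurable]: "(\<lambda>x. velocity c v X U D (snd x) (fst x)) \<in> borel_measurable (M \<Otimes>\<^sub>M lborel)"
    using measurable_cong_sets by blast
  have "(\<lambda>(\<omega>, s). indicator {0..t} s *\<^sub>R velocity c v X U D s \<omega>) \<in> borel_measurable (M \<Otimes>\<^sub>M lborel)"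
    unfolding case_prod_beta by measurable
  then show ?thesis
    unfolding position_def set_lebesgue_integral_def
    by (intro lborel.borel_measurable_lebesgue_integral) simp
qed


text \<open>
  Because the durations are positive, the event \<open>U\<^sub>1 + ... + U\<^sub>k\<^sub>+\<^sub>1 \<le> t\<close> is almost surely contained
  in \<open>U\<^sub>1 + ... + U\<^sub>k \<le> t\<close>.
\<close>

lemma prob_sojourn:
  "prob {\<omega> \<in> space M. (\<Sum>i=1..k. U i \<omega>) \<le> t \<and> t < (\<Sum>i=1..Suc k. U i \<omega>)} =
    partial_sum_cdf M U k t - partial_sum_cdf M U (k + 1) t"
proof -
  have S [measurable]: "(\<lambda>\<omega>. \<Sum>i=1..n. U i \<omega>) \<in> borel_measurable M" for n
    by (intro borel_measurable_sum U_measurable) simp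
  have F: "partial_sum_cdf M U n t = prob {\<omega> \<in> space M. (\<Sum>i=1..n. U i \<omega>) \<le> t}" for n
    unfolding partial_sum_cdf_def cdf_def
    using measure_distr[OF S[of n], of "{..t}"] by (simp add: vimage_def Int_def conj_commute)
  have "partial_sum_cdf M U k t =
    prob ({\<omega> \<in> space M. (\<Sum>i=1..k. U i \<omega>) \<le> t \<and> t < (\<Sum>i=1..Suc k. U i \<omega>)} \<union>
      {\<omega> \<in> space M. (\<Sum>i=1..Suc k. U i \<omega>) \<le> t})"
    unfolding F
  proof (rule finite_measure_eq_AE)
    show "AE \<omega> in M. (\<omega> \<in> {\<omega> \<in> space M. (\<Sum>i=1..k. U i \<omega>) \<le> t}) =
      (\<omega> \<in> {\<omega> \<in> space M. (\<Sum>i=1..k. U i \<omega>) \<le> t \<and> t < (\<Sum>i=1..Suc k. U i \<omega>)} \<union>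
        {\<omega> \<in> space M. (\<Sum>i=1..Suc k. U i \<omega>) \<le> t})"
      using U_pos[of "Suc k"] by (auto elim!: eventually_mono)
  qed measurable
  also have "\<dots> = prob {\<omega> \<in> space M. (\<Sum>i=1..k. U i \<omega>) \<le> t \<and> t < (\<Sum>i=1..Suc k. U i \<omega>)} +
      prob {\<omega> \<in> space M. (\<Sum>i=1..Suc k. U i \<omega>) \<le> t}"
    by (rule finite_measure_Union) (measurable, auto)
  finally show ?thesis unfolding F by simp
qed

lemma AE_position_eq_max_iff_ex1:
  assumes t: "t > 0"
    and no_atom: "\<And>k. k \<ge> 1 \<Longrightarrow> AE \<omega> in M. (\<Sum>i=1..k. U i \<omega>) \<noteq> t"
  defines "P \<equiv> \<lambda>k \<omega>. (\<forall>i\<in>{1..Suc k}. X i \<omega> = 1) \<and>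
      (\<Sum>i=1..k. U i \<omega>) \<le> t \<and> t < (\<Sum>i=1..Suc k. U i \<omega>)"
  shows "AE \<omega> in M. (\<forall>k. P k \<omega> \<longrightarrow> position c v X U D t \<omega> = c * t) \<and>
    (position c v X U D t \<omega> = c * t \<longrightarrow> (\<exists>!k. P k \<omega>))"
proof -
  have "AE \<omega> in M. \<forall>k. k \<ge> 1 \<longrightarrow> U k \<omega> > 0"
    unfolding AE_all_countable using U_pos by (auto intro: AE_impI)
  moreover have "AE \<omega> in M. \<forall>k. k \<ge> 1 \<longrightarrow> D k \<omega> > 0"
    unfolding AE_all_countable using D_pos by (auto intro: AE_impI)
  moreover have "AE \<omega> in M. \<forall>k. k \<ge> 1 \<longrightarrow> (\<Sum>i=1..k. U i \<omega>) \<noteq> t"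
    unfolding AE_all_countable using no_atom by (auto intro: AE_impI)
  ultimately show ?thesis
    using switch_time_unbounded AE_space
  proof eventually_elim
    case (elim \<omega>)
    have mono: "strict_mono (\<lambda>n. switch_time X U D n \<omega>)"
      using elim X_range[of \<omega>] by (intro strict_mono_switch_time) blast+
    have "(\<lambda>s. velocity c v X U D s \<omega>) \<in> borel_measurable borel"
      using measurable_compose[OF measurable_Pair2'[OF elim(5), of borel], of _ borel, OF velocity_measurable]
      by simp
    then have "position c v X U D t \<omega> = c * t \<longleftrightarrow>
        (\<forall>n. switch_time X U D n \<omega> < t \<longrightarrow> X (Suc n) \<omega> = 1)"
      by (intro position_eq_max_iff c_pos v_pos t mono elim(4))
    then show ?case
      using all_forward_iff_ex1[of U \<omega> t X D] elim t mono unfolding P_def by simp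
  qed
qed

text \<open>
  The event splits almost surely into disjoint events indexed by the number \<open>k\<close> of completed
  sojourns. Independence factors each of them, and the term \<open>k = 0\<close> is the probability that the first
  sojourn is forward and still lasts at time \<open>t\<close>.
\<close>

lemma prob_position_eq_max:
  assumes t: "t > 0"
    and no_atom: "\<And>k. k \<ge> 1 \<Longrightarrow> AE \<omega> in M. (\<Sum>i=1..k. U i \<omega>) \<noteq> t"
    and indep: "\<And>k. prob ({\<omega> \<in> space M. \<forall>i\<in>{1..Suc k}. X i \<omega> = 1} \<inter>
        {\<omega> \<in> space M. (\<Sum>i=1..k. U i \<omega>) \<le> t \<and> t < (\<Sum>i=1..Suc k. U i \<omega>)}) =
      prob {\<omega> \<in> space M. \<forall>i\<in>{1..Suc k}. X i \<omega> = 1} *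
      prob {\<omega> \<in> space M. (\<Sum>i=1..k. U i \<omega>) \<le> t \<and> t < (\<Sum>i=1..Suc k. U i \<omega>)}"
  defines "f \<equiv> \<lambda>k. prob {\<omega> \<in> space M. \<forall>i\<in>{1..Suc k}. X i \<omega> = 1} *
      (partial_sum_cdf M U k t - partial_sum_cdf M U (k + 1) t)"
  shows "f summable_on {1..}"
    and "prob {\<omega> \<in> space M. position c v X U D t \<omega> = c * t} =
      prob {\<omega> \<in> space M. X 1 \<omega> = 1} * tail_df M (U 1) t + infsum f {1..}"
proof -
  let ?P = "\<lambda>k \<omega>. (\<forall>i\<in>{1..Suc k}. X i \<omega> = 1) \<and>
      (\<Sum>i=1..k. U i \<omega>) \<le> t \<and> t < (\<Sum>i=1..Suc k. U i \<omega>)"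
  have [measurable]: "(\<lambda>\<omega>. \<Sum>i=1..n. U i \<omega>) \<in> borel_measurable M" for n
    by (intro borel_measurable_sum U_measurable) simp
  have [measurable]: "Measurable.pred M (\<lambda>\<omega>. \<forall>i\<in>{1..n}. X i \<omega> = 1)" for n
    using X_measurable_UNIV by (intro pred_intros_finite) auto
  note [measurable] = position_measurable
  have f: "f k = prob {\<omega> \<in> space M. ?P k \<omega>}" for k
    unfolding f_def prob_sojourn[symmetric] indep[symmetric]
    by (rule arg_cong[where f = prob]) auto
  have f_nonneg: "f k \<ge> 0" for k unfolding f by simp
  have "f sums prob {\<omega> \<in> space M. position c v X U D t \<omega> = c * t}"
    unfolding f
    by (rule prob_sums[OF _ _ AE_position_eq_max_iff_ex1[OF t no_atom]]) measurable
  then have hs: "(f has_sum prob {\<omega> \<in> space M. position c v X U D t \<omega> = c * t}) UNIV"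
    by (rule sums_nonneg_imp_has_sum) (rule f_nonneg)
  show sm: "f summable_on {1..}"
    using hs summable_on_subset_banach has_sum_imp_summable by blast
  have "(f has_sum (sum f {0} + infsum f {1..})) ({0} \<union> {1..})"
    by (intro has_sum_Un_disjoint has_sum_infsum[OF sm] has_sum_finite) auto
  moreover have "{0} \<union> {1..} = (UNIV :: nat set)" by auto
  ultimately have "prob {\<omega> \<in> space M. position c v X U D t \<omega> = c * t} = f 0 + infsum f {1..}"
    using hs has_sum_unique by fastforce
  moreover have "f 0 = prob {\<omega> \<in> space M. X 1 \<omega> = 1} * tail_df M (U 1) t"
    unfolding f_def prob_sojourn[symmetric] using t by (simp add: tail_df_def)
  ultimately show "prob {\<omega> \<in> space M. position c v X U D t \<omega> = c * t} =
      prob {\<omega> \<in> space M. X 1 \<omega> = 1} * tail_df M (U 1) t + infsum f {1..}" by simp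
qed

end

section \<open>Generated sigma-algebras and sums without atoms\<close>

lemma measurable_generated_algebra:
  assumes "i \<in> I" "\<And>j \<omega>. j \<in> I \<Longrightarrow> \<omega> \<in> space M \<Longrightarrow> Y j \<omega> \<in> space N"
  shows "Y i \<in> generated_algebra M I N Y \<rightarrow>\<^sub>M N"
proof -
  have "(\<lambda>\<omega>. \<lambda>i\<in>I. Y i \<omega>) \<in> generated_algebra M I N Y \<rightarrow>\<^sub>M PiM I (\<lambda>_. N)"
    unfolding generated_algebra_def
    by (rule measurable_vimage_algebra1) (use assms in \<open>auto simp: space_PiM\<close>)
  from measurable_compose[OF this measurable_component_singleton[OF assms(1)]]
  show ?thesis using assms(1) by simp
qed

lemma space_generated_algebra [simp]: "space (generated_algebra M I N Y) = space M"
  by (simp add: generated_algebra_def)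

lemma subalgebra_generated_algebra:
  assumes "\<And>j. j \<in> I \<Longrightarrow> Y j \<in> M \<rightarrow>\<^sub>M N"
  shows "subalgebra M (generated_algebra M I N Y)"
proof -
  have "(\<lambda>\<omega>. \<lambda>i\<in>I. Y i \<omega>) \<in> M \<rightarrow>\<^sub>M PiM I (\<lambda>_. N)"
    using assms by (rule measurable_restrict)
  then have "sets (generated_algebra M I N Y) \<subseteq> sets M"
    unfolding generated_algebra_def sets_vimage_algebra
    by (intro sets.sigma_sets_subset) (auto intro: measurable_sets)
  then show ?thesis by (simp add: subalgebra_def)
qed

text \<open>
  By Fubini: for every fixed value of \<open>Z\<close>, the atomless \<open>Y\<close> almost surely avoids \<open>t - Z\<close>.
\<close>

lemma (in prob_space) AE_indep_sum_neq:
  fixes Y Z :: "'a \<Rightarrow> real"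
  assumes indep: "indep_var borel Y borel Z" and no_atom: "\<And>x. AE \<omega> in M. Y \<omega> \<noteq> x"
  shows "AE \<omega> in M. Y \<omega> + Z \<omega> \<noteq> t"
proof -
  have [measurable]: "Y \<in> borel_measurable M" "Z \<in> borel_measurable M"
    using indep_var_rv1[OF indep] indep_var_rv2[OF indep] by auto
  interpret Y: prob_space "distr M borel Y" by (rule prob_space_distr) simp
  interpret Z: prob_space "distr M borel Z" by (rule prob_space_distr) simp
  interpret pair_sigma_finite "distr M borel Y" "distr M borel Z" ..
  have eq: "distr M borel Y \<Otimes>\<^sub>M distr M borel Z = distr M (borel \<Otimes>\<^sub>M borel) (\<lambda>\<omega>. (Y \<omega>, Z \<omega>))"
    using indep unfolding indep_var_distribution_eq by blast
  have "{x \<in> space (borel \<Otimes>\<^sub>M borel). fst x + snd x \<noteq> t} \<in> sets (borel \<Otimes>\<^sub>M (borel :: real measure))"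
    by measurable
  also have "sets (borel \<Otimes>\<^sub>M borel) = sets (distr M borel Y \<Otimes>\<^sub>M distr M borel Z)"
    by (intro sets_pair_measure_cong) simp_all
  finally have meas: "{x \<in> space (distr M borel Y \<Otimes>\<^sub>M distr M borel Z). fst x + snd x \<noteq> t}
      \<in> sets (distr M borel Y \<Otimes>\<^sub>M distr M borel Z)"
    by (simp add: space_pair_measure)
  have "AE y in distr M borel Y. y \<noteq> t - z" for z
    using no_atom by (subst AE_distr_iff) auto
  then have sections: "AE y in distr M borel Y. y + z \<noteq> t" for z
    by (auto simp: eq_diff_eq elim!: eventually_mono)
  \<comment> \<open>The inner section is over the atomless component, so the order of integration is reversed.\<close>
  have "AE z in distr M borel Z. AE y in distr M borel Y. y + z \<noteq> t"
    by (rule AE_I2) (rule sections)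
  then have "AE y in distr M borel Y. AE z in distr M borel Z. y + z \<noteq> t"
    using AE_commute[of "\<lambda>y z. y + z \<noteq> t", OF meas] by blast
  then have "AE x in distr M borel Y \<Otimes>\<^sub>M distr M borel Z. fst x + snd x \<noteq> t"
    by (intro AE_pair_measure meas) simp
  then show ?thesis
    unfolding eq by (subst (asm) AE_distr_iff) auto
qed

lemma (in prob_space) AE_sum_neq:
  fixes W :: "'i \<Rightarrow> 'a \<Rightarrow> real"
  assumes indep: "indep_vars (\<lambda>_. borel) W I" and J: "finite J" "J \<subseteq> I"
    and i: "i \<in> J" and no_atom: "\<And>x. AE \<omega> in M. W i \<omega> \<noteq> x"
  shows "AE \<omega> in M. (\<Sum>i\<in>J. W i \<omega>) \<noteq> t"
proof -
  have "indep_vars (\<lambda>_. borel) W (insert i (J - {i}))"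
    by (rule indep_vars_subset[OF indep]) (use i J in auto)
  then have "indep_var borel (W i) borel (\<lambda>\<omega>. \<Sum>j\<in>J - {i}. W j \<omega>)"
    by (rule indep_vars_sum[rotated 2]) (use J in auto)
  then have "AE \<omega> in M. W i \<omega> + (\<Sum>j\<in>J - {i}. W j \<omega>) \<noteq> t"
    by (rule AE_indep_sum_neq) (rule no_atom)
  then show ?thesis by (simp only: sum.remove[OF J(1) i])
qed

lemma AE_neq_of_absolutely_continuous:
  fixes Y :: "'a \<Rightarrow> real"
  assumes "absolutely_continuous lborel (distr M lborel Y)" "Y \<in> borel_measurable M"
  shows "AE \<omega> in M. Y \<omega> \<noteq> x"
proof -
  have "{x} \<in> null_sets (lborel :: real measure)" by (intro null_setsI) auto
  then have "{x} \<in> null_sets (distr M lborel Y)"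
    using assms(1) unfolding absolutely_continuous_def by blast
  then have "AE y in distr M lborel Y. y \<notin> {x}" by (rule AE_not_in)
  then show ?thesis using assms(2) by (subst (asm) AE_distr_iff) auto
qed

section \<open>Exchanging the two directions\<close>

text \<open>
  Exchanging successes with failures and forward with backward durations only renames the two
  directions: after each trial, the counts of successes and failures trade places, and so do the
  sequences that they index. Hence the switching times stay the same.
\<close>

lemma switch_time_swap:
  assumes X: "\<And>i. i \<ge> 1 \<Longrightarrow> X i \<omega> \<in> {0, 1}"
  shows "switch_time (\<lambda>n \<omega>. 1 - X n \<omega>) D U n \<omega> = switch_time X U D n \<omega>"
proof (induction n)
  case (Suc n)
  have le: "X i \<omega> \<le> 1" if "i \<in> {1..Suc n}" for i using X[of i] that by auto
  have "success_count (\<lambda>n \<omega>. 1 - X n \<omega>) n \<omega> = (\<Sum>i=1..Suc n. 1) - (\<Sum>i=1..Suc n. X i \<omega>)"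
    unfolding success_count_def using le by (rule sum_subtractf_nat)
  then have swap: "success_count (\<lambda>n \<omega>. 1 - X n \<omega>) n \<omega> = Suc n - success_count X n \<omega>"
    unfolding success_count_def by simp
  have "success_count X n \<omega> \<le> (\<Sum>i=1..Suc n. 1)"
    unfolding success_count_def using le by (rule sum_mono)
  then have "Suc n - success_count (\<lambda>n \<omega>. 1 - X n \<omega>) n \<omega> = success_count X n \<omega>"
    unfolding swap by simp
  then show ?case
    using X[of "Suc n"] swap Suc by (auto simp: switch_time.simps(2))
qed simp

lemma position_swap:
  assumes X: "\<And>i. i \<ge> 1 \<Longrightarrow> X i \<omega> \<in> {0, 1}"
  shows "position v c (\<lambda>n \<omega>. 1 - X n \<omega>) D U t \<omega> = - position c v X U D t \<omega>"
proof -
  have "trial_velocity v c (\<lambda>n \<omega>. 1 - X n \<omega>) n \<omega> = - trial_velocity c v X n \<omega>" for n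
    using X[of "Suc n"] by (auto simp: trial_velocity_def)
  moreover have "switch_count (\<lambda>n \<omega>. 1 - X n \<omega>) D U s \<omega> = switch_count X U D s \<omega>" for s
    unfolding switch_count_def using switch_time_swap[of X \<omega> D U, OF X] by simp
  ultimately show ?thesis
    unfolding position_def velocity_def set_lebesgue_integral_def by simp
qed

context trial_telegraph
begin

lemma durations_measurable:
  assumes "k \<ge> 1"
  shows "U k \<in> borel_measurable M" "D k \<in> borel_measurable M"
proof -
  have "case_sum U D z \<in> borel_measurable M" if "z \<in> {1..} <+> {1..}" for z
    using UD_indep that unfolding indep_vars_def2 by auto
  from this[of "Inl k"] this[of "Inr k"] assms
  show "U k \<in> borel_measurable M" "D k \<in> borel_measurable M" by auto
qed

lemma AE_durations_neq:
  assumes "k \<ge> 1"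
  shows "AE \<omega> in M. U k \<omega> \<noteq> x" "AE \<omega> in M. D k \<omega> \<noteq> x"
  using assms durations_measurable U_abs_cont D_abs_cont
  by (auto intro!: AE_neq_of_absolutely_continuous)

lemma AE_durations_pos:
  assumes "k \<ge> 1"
  shows "AE \<omega> in M. U k \<omega> > 0" "AE \<omega> in M. D k \<omega> > 0"
  subgoal using AE_durations_neq(1)[OF assms, of 0] U_nonneg[OF assms] by eventually_elim simp
  subgoal using AE_durations_neq(2)[OF assms, of 0] D_nonneg[OF assms] by eventually_elim simp
  done

lemma AE_duration_sums_neq:
  assumes "k \<ge> 1"
  shows "AE \<omega> in M. (\<Sum>i=1..k. U i \<omega>) \<noteq> t" "AE \<omega> in M. (\<Sum>i=1..k. D i \<omega>) \<noteq> t"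
proof -
  have "AE \<omega> in M. (\<Sum>z\<in>Inl ` {1..k}. case_sum U D z \<omega>) \<noteq> t"
    by (rule AE_sum_neq[OF UD_indep, where i = "Inl 1"]) (use assms in \<open>auto simp: AE_durations_neq\<close>)
  then show "AE \<omega> in M. (\<Sum>i=1..k. U i \<omega>) \<noteq> t" by (simp add: sum.reindex)
  have "AE \<omega> in M. (\<Sum>z\<in>Inr ` {1..k}. case_sum U D z \<omega>) \<noteq> t"
    by (rule AE_sum_neq[OF UD_indep, where i = "Inr 1"]) (use assms in \<open>auto simp: AE_durations_neq\<close>)
  then show "AE \<omega> in M. (\<Sum>i=1..k. D i \<omega>) \<noteq> t" by (simp add: sum.reindex)
qed

sublocale forward: two_speed_motion M c v X U D
  by unfold_locales (rule c_pos v_pos X_measurable durations_measurable AE_durations_pos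
    switch_time_unbounded | assumption)+

sublocale backward: two_speed_motion M v c "\<lambda>n \<omega>. 1 - X n \<omega>" D U
proof
  show "(\<lambda>\<omega>. 1 - X n \<omega>) \<in> M \<rightarrow>\<^sub>M count_space {0, 1}" if "n \<ge> 1" for n
    using measurable_compose[OF X_measurable[OF that], of "\<lambda>x. 1 - x" "count_space {0, 1}"] by simp
  show "AE \<omega> in M. filterlim (\<lambda>n. switch_time (\<lambda>n \<omega>. 1 - X n \<omega>) D U n \<omega>) at_top sequentially"
    using switch_time_unbounded AE_space
  proof eventually_elim
    case (elim \<omega>)
    then show ?case using switch_time_swap[of X \<omega> D U] forward.X_range[of \<omega>] by simp
  qed
qed (rule c_pos v_pos durations_measurable AE_durations_pos | assumption)+

end

section \<open>Laws of runs of equal trials\<close>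

lemma sum_of_bool_Icc_eq_iff:
  "(\<Sum>i=1..k. of_bool (P i) :: nat) = k \<longleftrightarrow> (\<forall>i\<in>{1..k}. P i)"
proof -
  have "(\<Sum>i=1..k. of_bool (P i) :: nat) = card {i \<in> {1..k}. P i}"
    by (subst sum_of_bool_eq) (auto simp: Int_def)
  also have "\<dots> = k \<longleftrightarrow> {i \<in> {1..k}. P i} = {1..k}"
  proof
    assume "card {i \<in> {1..k}. P i} = k"
    then show "{i \<in> {1..k}. P i} = {1..k}" by (intro card_subset_eq) auto
  qed simp
  finally show ?thesis by blast
qed

lemma ball_Icc_Suc: "(\<forall>i\<in>{1..Suc n}. P i) \<longleftrightarrow> (\<forall>i\<in>{1..n}. P i) \<and> P (Suc n)"
  by (auto simp: atLeastAtMostSuc_conv)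

lemma ball_Icc_shift: "(\<forall>i\<in>{1..Suc n}. P i) \<longleftrightarrow> P 1 \<and> (\<forall>i\<in>{1..n}. P (Suc i))"
proof -
  have "{1..Suc n} = insert 1 (Suc ` {1..n})"
    unfolding image_Suc_atLeastAtMost by (subst atLeastAtMost_insertL) simp_all
  then show ?thesis by (elim ssubst) blast
qed

text \<open>
  For \<open>A > 0\<close>, dividing numerators and denominators by \<open>A\<close> turns the factors after the first one
  into those of two ascending factorials.
\<close>

lemma prod_affine_ratio:
  fixes a s A :: real
  assumes "s > 0" "A \<ge> 0"
  shows "(\<Prod>i<Suc k. (a + A * real i) / (s + A * real i)) =
    (if A = 0 then (a / s) ^ (k + 1)
     else a / s * pochhammer ((a + A) / A) k * inverse (pochhammer ((s + A) / A) k))"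
proof (cases "A = 0")
  case False
  then have A: "A > 0" using assms by simp
  have "(\<Prod>i<Suc k. (a + A * real i) / (s + A * real i)) =
     a / s * pochhammer ((a + A) / A) k * inverse (pochhammer ((s + A) / A) k)"
  proof (induction k)
    case (Suc k)
    have "(a + A) / A + real k = (a + A * real (k + 1)) / A"
      "(s + A) / A + real k = (s + A * real (k + 1)) / A"
      using A by (simp_all add: field_simps)
    then have "(a + A * real (k + 1)) / (s + A * real (k + 1)) =
        ((a + A) / A + real k) * inverse ((s + A) / A + real k)"
      using A by (simp add: divide_inverse)
    moreover have "(\<Prod>i<Suc (Suc k). (a + A * real i) / (s + A * real i)) =
      (\<Prod>i<Suc k. (a + A * real i) / (s + A * real i)) * ((a + A * real (k + 1)) / (s + A * real (k + 1)))"
      by simp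
    ultimately show ?case
      unfolding Suc pochhammer_Suc by (simp add: mult_ac)
  qed simp
  then show ?thesis using False by simp
qed simp

context trial_telegraph
begin

lemma run_in_generated_algebra:
  assumes "{1..n} \<subseteq> I"
  shows "{\<omega> \<in> space M. \<forall>i\<in>{1..n}. X i \<omega> = e} \<in> sets (generated_algebra M I (count_space UNIV) X)"
proof -
  let ?F = "generated_algebra M I (count_space UNIV) X"
  have "Measurable.pred ?F (\<lambda>\<omega>. \<forall>i\<in>{1..n}. X i \<omega> = e)"
  proof (rule pred_intros_finite)
    fix i assume "i \<in> {1..n}"
    then have [measurable]: "X i \<in> ?F \<rightarrow>\<^sub>M count_space UNIV"
      using assms by (intro measurable_generated_algebra) auto
    show "Measurable.pred ?F (\<lambda>\<omega>. X i \<omega> = e)" by measurable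
  qed simp
  then show ?thesis by (simp add: pred_def)
qed

text \<open>
  This is the only place where the conditional law of the trials enters: on the event that the
  first \<open>n\<close> trials all equal \<open>e\<close>, their sum is \<open>n e\<close>, hence the conditional probability
  of a success is constant there and factors out of the integral.
\<close>

lemma prob_run_then_success:
  assumes n: "n \<ge> 1"
  shows "prob {\<omega> \<in> space M. (\<forall>i\<in>{1..n}. X i \<omega> = e) \<and> X (Suc n) \<omega> = 1} =
    prob {\<omega> \<in> space M. \<forall>i\<in>{1..n}. X i \<omega> = e} * ((b + A * (real n * real e)) / (b + r + A * real n))"
proof -
  let ?F = "generated_algebra M {1..n} (count_space UNIV) X"
  let ?B = "{\<omega> \<in> space M. \<forall>i\<in>{1..n}. X i \<omega> = e}"
  let ?C = "{\<omega> \<in> space M. X (Suc n) \<omega> = 1}"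
  let ?q = "(b + A * (real n * real e)) / (b + r + A * real n)"
  have sub: "subalgebra M ?F" by (rule subalgebra_generated_algebra) (simp add: forward.X_measurable_UNIV)
  interpret sigma_finite_subalgebra M ?F
    by (rule finite_measure_subalgebra_is_sigma_finite) (unfold_locales, rule sub)
  have B: "?B \<in> sets ?F" by (rule run_in_generated_algebra) simp
  then have BM [measurable]: "?B \<in> sets M" using sub unfolding subalgebra_def by blast
  have [measurable]: "X (Suc n) \<in> M \<rightarrow>\<^sub>M count_space UNIV" by (rule forward.X_measurable_UNIV) simp
  have C [measurable]: "?C \<in> sets M" by measurable
  have "prob {\<omega> \<in> space M. (\<forall>i\<in>{1..n}. X i \<omega> = e) \<and> X (Suc n) \<omega> = 1} = prob (?C \<inter> ?B)"
    by (rule arg_cong[where f = prob]) auto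
  also have "\<dots> = prob ((?C \<inter> ?B) \<inter> space M)"
    by (rule arg_cong[where f = prob]) auto
  also have "\<dots> = (\<integral>\<omega>. indicator (?C \<inter> ?B) \<omega> \<partial>M)"
    by (rule Bochner_Integration.integral_indicator[symmetric])
  also have "\<dots> = (LINT \<omega>:?B|M. indicator ?C \<omega>)"
    unfolding set_lebesgue_integral_def
    by (rule Bochner_Integration.integral_cong) (auto simp: indicator_def)
  also have "\<dots> = (LINT \<omega>:?B|M. real_cond_exp M ?F (indicator ?C) \<omega>)"
    by (intro real_cond_exp_intA B integrable_real_indicator C) (simp add: emeasure_eq_measure)
  also have "\<dots> = (LINT \<omega>:?B|M. ?q)"
  proof (rule set_lebesgue_integral_cong_AE)
    show "AE \<omega> in M. \<omega> \<in> ?B \<longrightarrow> real_cond_exp M ?F (indicator ?C) \<omega> = ?q"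
      using X_step[OF n] by (auto elim!: eventually_mono)
  qed measurable
  also have "\<dots> = prob ?B * ?q"
    unfolding set_lebesgue_integral_def by (simp add: Int_absorb2)
  finally show ?thesis .
qed

lemma prob_failure_first: "prob {\<omega> \<in> space M. X 1 \<omega> = 0} = r / (b + r)"
proof -
  have [measurable]: "X 1 \<in> M \<rightarrow>\<^sub>M count_space UNIV" by (rule forward.X_measurable_UNIV) simp
  have "{\<omega> \<in> space M. X 1 \<omega> = 0} = space M - {\<omega> \<in> space M. X 1 \<omega> = 1}"
    using forward.X_range[of _ 1] by auto
  moreover have "{\<omega> \<in> space M. X 1 \<omega> = 1} \<in> events" by measurable
  ultimately have "prob {\<omega> \<in> space M. X 1 \<omega> = 0} = 1 - b / (b + r)"
    using prob_compl X_first by metis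
  then show ?thesis using b_pos r_pos by (simp add: field_simps)
qed

lemma prob_success_run:
  "prob {\<omega> \<in> space M. \<forall>i\<in>{1..Suc k}. X i \<omega> = 1} =
    (\<Prod>i<Suc k. (b + A * real i) / (b + r + A * real i))"
proof (induction k)
  case 0
  then show ?case using X_first by simp
next
  case (Suc k)
  have "prob {\<omega> \<in> space M. \<forall>i\<in>{1..Suc (Suc k)}. X i \<omega> = 1} =
    prob {\<omega> \<in> space M. (\<forall>i\<in>{1..Suc k}. X i \<omega> = 1) \<and> X (Suc (Suc k)) \<omega> = 1}"
    by (rule arg_cong[where f = prob]) (simp only: ball_Icc_Suc[of "Suc k"])
  then show ?case using prob_run_then_success[of "Suc k" 1] Suc.IH by simp
qed

text \<open>
  A run of \<open>k + 1\<close> failures extends by another failure exactly when it is not followed by a success,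
  which turns the factor \<open>b / (b + r + A (k + 1))\<close> into its complement.
\<close>

lemma prob_failure_run:
  "prob {\<omega> \<in> space M. \<forall>i\<in>{1..Suc k}. X i \<omega> = 0} =
    (\<Prod>i<Suc k. (r + A * real i) / (b + r + A * real i))"
proof (induction k)
  case 0
  then show ?case using prob_failure_first by simp
next
  case (Suc k)
  let ?B = "{\<omega> \<in> space M. \<forall>i\<in>{1..Suc k}. X i \<omega> = 0}"
  let ?S = "{\<omega> \<in> space M. (\<forall>i\<in>{1..Suc k}. X i \<omega> = 0) \<and> X (Suc (Suc k)) \<omega> = 1}"
  have [measurable]: "Measurable.pred M (\<lambda>\<omega>. \<forall>i\<in>{1..Suc k}. X i \<omega> = 0)"
    using forward.X_measurable_UNIV by (intro pred_intros_finite) auto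
  have [measurable]: "X (Suc (Suc k)) \<in> M \<rightarrow>\<^sub>M count_space UNIV" by (rule forward.X_measurable_UNIV) simp
  have pos: "b + r + A * real (Suc k) > 0" using b_pos r_pos A_nonneg by (simp add: add_pos_nonneg)
  have "{\<omega> \<in> space M. \<forall>i\<in>{1..Suc (Suc k)}. X i \<omega> = 0} = ?B - ?S"
    unfolding ball_Icc_Suc[of "Suc k"] using forward.X_range[of _ "Suc (Suc k)"] by fastforce
  moreover have "prob (?B - ?S) = prob ?B - prob ?S"
  proof (rule finite_measure_Diff)
    show "?B \<in> events" "?S \<in> events" by measurable
  qed auto
  ultimately have "prob {\<omega> \<in> space M. \<forall>i\<in>{1..Suc (Suc k)}. X i \<omega> = 0} = prob ?B - prob ?S"
    by (simp only:)
  also have "\<dots> = prob ?B * (1 - b / (b + r + A * real (Suc k)))"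
    using prob_run_then_success[of "Suc k" 0] by (simp add: algebra_simps)
  also have "1 - b / (b + r + A * real (Suc k)) = (r + A * real (Suc k)) / (b + r + A * real (Suc k))"
    using pos by (simp add: field_simps)
  finally show ?case using Suc by simp
qed

lemma success_run_iff:
  "trial_velocity c v X 0 \<omega> = c \<and> forward_count c v X k \<omega> = k \<longleftrightarrow> (\<forall>i\<in>{1..Suc k}. X i \<omega> = 1)"
proof -
  have tv: "trial_velocity c v X i \<omega> = c \<longleftrightarrow> X (Suc i) \<omega> = 1" for i
    using c_pos v_pos by (simp add: trial_velocity_def)
  show ?thesis unfolding forward_count_def sum_of_bool_Icc_eq_iff tv ball_Icc_shift by simp
qed

lemma failure_run_iff:
  assumes "\<omega> \<in> space M"
  shows "trial_velocity c v X 0 \<omega> = - v \<and> forward_count c v X k \<omega> = 0 \<longleftrightarrow>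
    (\<forall>i\<in>{1..Suc k}. X i \<omega> = 0)"
proof -
  have X: "X (Suc i) \<omega> \<noteq> 1 \<longleftrightarrow> X (Suc i) \<omega> = 0" for i
    using forward.X_range[OF assms, of "Suc i"] by auto
  have tv: "trial_velocity c v X i \<omega> \<noteq> c \<longleftrightarrow> X (Suc i) \<omega> = 0"
    "trial_velocity c v X i \<omega> = - v \<longleftrightarrow> X (Suc i) \<omega> = 0" for i
    using c_pos v_pos X[of i] by (auto simp: trial_velocity_def)
  have "forward_count c v X k \<omega> = 0 \<longleftrightarrow> (\<forall>i\<in>{1..k}. trial_velocity c v X i \<omega> \<noteq> c)"
    unfolding forward_count_def by auto
  then show ?thesis unfolding tv ball_Icc_shift by simp
qed

lemma prob_success_run_eq_pochhammer:
  "prob {\<omega> \<in> space M. \<forall>i\<in>{1..Suc k}. X i \<omega> = 1} =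
    (if A = 0 then (b / (b + r)) ^ (k + 1)
     else b / (b + r) * pochhammer ((b + A) / A) k * inverse (pochhammer ((b + A + r) / A) k))"
proof -
  have "b + r + A = b + A + r" by simp
  moreover have "b + r > 0" using b_pos r_pos by simp
  ultimately show ?thesis
    using prod_affine_ratio[of "b + r" A b k] A_nonneg
    unfolding prob_success_run by (simp only: Suc_eq_plus1 if_cancel)
qed

lemma prob_failure_run_eq_pochhammer:
  "prob {\<omega> \<in> space M. \<forall>i\<in>{1..Suc k}. X i \<omega> = 0} =
    (if A = 0 then (1 - b / (b + r)) ^ (k + 1)
     else r / (b + r) * pochhammer ((r + A) / A) k * inverse (pochhammer ((b + A + r) / A) k))"
proof -
  have "1 - b / (b + r) = r / (b + r)" using b_pos r_pos by (simp add: field_simps)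
  moreover have "b + r + A = b + A + r" by simp
  moreover have "b + r > 0" using b_pos r_pos by simp
  ultimately show ?thesis
    using prod_affine_ratio[of "b + r" A r k] A_nonneg
    unfolding prob_failure_run by (simp only: Suc_eq_plus1 if_cancel)
qed

section \<open>The extremal positions of the telegraph process\<close>

lemma prob_run_Int_durations:
  assumes "S \<in> sets (generated_algebra M ({1..} <+> {1..}) borel (case_sum U D))"
  shows "prob ({\<omega> \<in> space M. \<forall>i\<in>{1..n}. X i \<omega> = e} \<inter> S) =
    prob {\<omega> \<in> space M. \<forall>i\<in>{1..n}. X i \<omega> = e} * prob S"
  by (rule indep_setD[OF X_UD_indep run_in_generated_algebra assms]) auto

lemma sojourns_in_generated_algebra:
  "{\<omega> \<in> space M. (\<Sum>i=1..k. U i \<omega>) \<le> t \<and> t < (\<Sum>i=1..Suc k. U i \<omega>)}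
    \<in> sets (generated_algebra M ({1..} <+> {1..}) borel (case_sum U D))"
  "{\<omega> \<in> space M. (\<Sum>i=1..k. D i \<omega>) \<le> t \<and> t < (\<Sum>i=1..Suc k. D i \<omega>)}
    \<in> sets (generated_algebra M ({1..} <+> {1..}) borel (case_sum U D))"
proof -
  let ?G = "generated_algebra M ({1..} <+> {1..}) borel (case_sum U D)"
  have G: "case_sum U D z \<in> borel_measurable ?G" if "z \<in> {1..} <+> {1..}" for z
    using that by (rule measurable_generated_algebra) simp
  have [measurable]: "(\<lambda>\<omega>. \<Sum>i=1..n. U i \<omega>) \<in> borel_measurable ?G" for n
    using G[of "Inl _"] by (intro borel_measurable_sum) auto
  have [measurable]: "(\<lambda>\<omega>. \<Sum>i=1..n. D i \<omega>) \<in> borel_measurable ?G" for n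
    using G[of "Inr _"] by (intro borel_measurable_sum) auto
  have "{\<omega> \<in> space ?G. (\<Sum>i=1..k. U i \<omega>) \<le> t \<and> t < (\<Sum>i=1..Suc k. U i \<omega>)} \<in> sets ?G"
    "{\<omega> \<in> space ?G. (\<Sum>i=1..k. D i \<omega>) \<le> t \<and> t < (\<Sum>i=1..Suc k. D i \<omega>)} \<in> sets ?G"
    by measurable
  then show "{\<omega> \<in> space M. (\<Sum>i=1..k. U i \<omega>) \<le> t \<and> t < (\<Sum>i=1..Suc k. U i \<omega>)} \<in> sets ?G"
    "{\<omega> \<in> space M. (\<Sum>i=1..k. D i \<omega>) \<le> t \<and> t < (\<Sum>i=1..Suc k. D i \<omega>)} \<in> sets ?G"
    by (simp_all del: sum.cl_ivl_Suc)
qed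

lemma prob_position_eq_forward_speed:
  assumes t: "t > 0"
  defines "f \<equiv> \<lambda>k. prob {\<omega> \<in> space M. \<forall>i\<in>{1..Suc k}. X i \<omega> = 1} *
      (partial_sum_cdf M U k t - partial_sum_cdf M U (k + 1) t)"
  shows "f summable_on {1..}"
    "prob {\<omega> \<in> space M. position c v X U D t \<omega> = c * t} =
      b / (b + r) * tail_df M (U 1) t + infsum f {1..}"
proof -
  have indep: "prob ({\<omega> \<in> space M. \<forall>i\<in>{1..Suc k}. X i \<omega> = 1} \<inter>
        {\<omega> \<in> space M. (\<Sum>i=1..k. U i \<omega>) \<le> t \<and> t < (\<Sum>i=1..Suc k. U i \<omega>)}) =
      prob {\<omega> \<in> space M. \<forall>i\<in>{1..Suc k}. X i \<omega> = 1} *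
      prob {\<omega> \<in> space M. (\<Sum>i=1..k. U i \<omega>) \<le> t \<and> t < (\<Sum>i=1..Suc k. U i \<omega>)}" for k
    by (rule prob_run_Int_durations[OF sojourns_in_generated_algebra(1)])
  note main = forward.prob_position_eq_max[OF t AE_duration_sums_neq(1) indep]
  show "f summable_on {1..}" using main(1) unfolding f_def by simp
  show "prob {\<omega> \<in> space M. position c v X U D t \<omega> = c * t} =
      b / (b + r) * tail_df M (U 1) t + infsum f {1..}"
    using main(2) unfolding f_def X_first by simp
qed

lemma prob_position_eq_backward_speed:
  assumes t: "t > 0"
  defines "f \<equiv> \<lambda>k. prob {\<omega> \<in> space M. \<forall>i\<in>{1..Suc k}. X i \<omega> = 0} *
      (partial_sum_cdf M D k t - partial_sum_cdf M D (k + 1) t)"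
  shows "f summable_on {1..}"
    "prob {\<omega> \<in> space M. position c v X U D t \<omega> = - v * t} =
      r / (b + r) * tail_df M (D 1) t + infsum f {1..}"
proof -
  have flip: "1 - X i \<omega> = 1 \<longleftrightarrow> X i \<omega> = 0" for i \<omega> by auto
  have indep: "prob ({\<omega> \<in> space M. \<forall>i\<in>{1..Suc k}. 1 - X i \<omega> = 1} \<inter>
        {\<omega> \<in> space M. (\<Sum>i=1..k. D i \<omega>) \<le> t \<and> t < (\<Sum>i=1..Suc k. D i \<omega>)}) =
      prob {\<omega> \<in> space M. \<forall>i\<in>{1..Suc k}. 1 - X i \<omega> = 1} *
      prob {\<omega> \<in> space M. (\<Sum>i=1..k. D i \<omega>) \<le> t \<and> t < (\<Sum>i=1..Suc k. D i \<omega>)}" for k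
    unfolding flip by (rule prob_run_Int_durations[OF sojourns_in_generated_algebra(2)])
  note main = backward.prob_position_eq_max[OF t AE_duration_sums_neq(2) indep, unfolded flip]
  show "f summable_on {1..}" using main(1) unfolding f_def by simp
  have "position v c (\<lambda>n \<omega>. 1 - X n \<omega>) D U t \<omega> = - position c v X U D t \<omega>" if "\<omega> \<in> space M" for \<omega>
    by (rule position_swap) (rule forward.X_range[OF that])
  then have "{\<omega> \<in> space M. position c v X U D t \<omega> = - v * t} =
      {\<omega> \<in> space M. position v c (\<lambda>n \<omega>. 1 - X n \<omega>) D U t \<omega> = v * t}"
    by (auto simp: minus_equation_iff)
  then show "prob {\<omega> \<in> space M. position c v X U D t \<omega> = - v * t} =
      r / (b + r) * tail_df M (D 1) t + infsum f {1..}"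
    using main(2) unfolding f_def prob_failure_first by simp
qed

end

theorem proposition3p1:
  fixes M :: "'a measure"
    and c v b r A :: real
    and X :: "nat \<Rightarrow> 'a \<Rightarrow> nat"
    and U D :: "nat \<Rightarrow> 'a \<Rightarrow> real"
  assumes "trial_telegraph M c v b r A X U D"
  shows
    "(\<forall>t>0.
        (\<lambda>k. \<P>(\<omega> in M. trial_velocity c v X 0 \<omega> = c \<and> forward_count c v X k \<omega> = k) *
              (partial_sum_cdf M U k t - partial_sum_cdf M U (k + 1) t)) summable_on {1..} \<and>
        \<P>(\<omega> in M. position c v X U D t \<omega> = c * t) =
          b / (b + r) * tail_df M (U 1) t +
          (\<Sum>\<^sub>\<infinity>k\<in>{1..}.
             \<P>(\<omega> in M. trial_velocity c v X 0 \<omega> = c \<and> forward_count c v X k \<omega> = k) *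
             (partial_sum_cdf M U k t - partial_sum_cdf M U (k + 1) t))) \<and>
     (\<forall>k\<ge>1.
        \<P>(\<omega> in M. trial_velocity c v X 0 \<omega> = c \<and> forward_count c v X k \<omega> = k) =
          (if A = 0 then (b / (b + r)) ^ (k + 1)
           else b / (b + r) * pochhammer ((b + A) / A) k *
                inverse (pochhammer ((b + A + r) / A) k))) \<and>
     (\<forall>t>0.
        (\<lambda>k. \<P>(\<omega> in M. trial_velocity c v X 0 \<omega> = - v \<and> forward_count c v X k \<omega> = 0) *
              (partial_sum_cdf M D k t - partial_sum_cdf M D (k + 1) t)) summable_on {1..} \<and>
        \<P>(\<omega> in M. position c v X U D t \<omega> = - v * t) =
          r / (b + r) * tail_df M (D 1) t +
          (\<Sum>\<^sub>\<infinity>k\<in>{1..}.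
             \<P>(\<omega> in M. trial_velocity c v X 0 \<omega> = - v \<and> forward_count c v X k \<omega> = 0) *
             (partial_sum_cdf M D k t - partial_sum_cdf M D (k + 1) t))) \<and>
     (\<forall>k\<ge>1.
        \<P>(\<omega> in M. trial_velocity c v X 0 \<omega> = - v \<and> forward_count c v X k \<omega> = 0) =
          (if A = 0 then (1 - b / (b + r)) ^ (k + 1)
           else r / (b + r) * pochhammer ((r + A) / A) k *
                inverse (pochhammer ((b + A + r) / A) k)))"
proof -
  interpret trial_telegraph M c v b r A X U D by (rule assms)
  have success: "{\<omega> \<in> space M. trial_velocity c v X 0 \<omega> = c \<and> forward_count c v X k \<omega> = k} =
      {\<omega> \<in> space M. \<forall>i\<in>{1..Suc k}. X i \<omega> = 1}" for k
    unfolding success_run_iff by simp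
  have failure: "{\<omega> \<in> space M. trial_velocity c v X 0 \<omega> = - v \<and> forward_count c v X k \<omega> = 0} =
      {\<omega> \<in> space M. \<forall>i\<in>{1..Suc k}. X i \<omega> = 0}" for k
    by (rule Collect_cong) (use failure_run_iff in auto)
  show ?thesis
    unfolding success failure
    by (intro conjI allI impI prob_position_eq_forward_speed prob_position_eq_backward_speed
        prob_success_run_eq_pochhammer prob_failure_run_eq_pochhammer)
qed

end
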